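(* Let $(X_n)_n$ be orthogonal random variables such that $\mathbb{E}X_n=0$ and $\mathbb{E}X_n^2=1$ for all $n$. Let $M(u):=\sum_{n\le u}X_n$ denote the partial sums of $X_n$. Assume that for some $1\le q_1<q_2\le 2$, as $x\to\infty$, the $L^{q_1}$ and $L^{q_2}$ norms satisfy the linearity condition $\|M(x)\|_{q_1}\asymp\|M(x)\|_{q_2}$. Assume further that $$\|M(x)\|_{q_1}\asymp\frac{\sqrt{x}}{\psi(x)},$$ for some continuous and non-decreasing function $\psi:[1,\infty)\to[1,\infty)$. Further, assume that for $n=o(\log x)$, $$\psi(e^nx)=\psi(x)\left(1+O\left(\frac{n}{\log x}\right)\right).$$ If $\psi(x)^{2+\epsilon}\ll N=o(\log x)$ for some small fixed $0<\epsilon<1/100$, then the probability that $M(u)$ has at least one sign change in the interval $u\in[x,e^Nx]$ is at least an absolute constant $\kappa>0$, if $x$ is sufficiently large.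
   Context: Here $n$ and $N$ denote positive integers and $x,u\ge1$ are real. Orthogonal means $\mathbb{E}X_nX_m=0$ for $n\ne m$. $\|X\|_q=(\mathbb{E}|X|^q)^{1/q}$. The notation $g\ll h$, or $g=O(h)$, means that there is a constant $c>0$ with $|g(x)|\le c|h(x)|$ for all $x$ in the relevant set of parameters (when not specified, an interval $(a,\infty)$ with $a>0$ sufficiently large); $g\asymp h$ means that both $g\ll h$ and $h\ll g$ hold; $g(x)=o(h(x))$ means $g(x)/h(x)\to0$, here as $x\to\infty$. $M(u)$ has at least one sign change in an interval if it takes both a positive and a negative value there.
   Formalization: Adds the assumption that N tends to infinity with x (automatic if ψ is unbounded; the claim fails for bounded ψ and constant N), and κ depends on q_1, q_2 and the implied constant of the linearity condition, since a fully absolute κ is impossible. *)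

theory Defs
  imports "HOL-Probability.Probability" "HOL-Library.Landau_Symbols"
begin

(* Square integrability needs no separate clause: the Bochner integral of a
   non-integrable function is 0, so the last clause makes every X n (n >= 1) square
   integrable, and all other expectations below are then genuine.  X 0 is not used. *)
definition orthonormal_centered :: "'a measure \<Rightarrow> (nat \<Rightarrow> 'a \<Rightarrow> real) \<Rightarrow> bool" where
  "orthonormal_centered P X \<longleftrightarrow>
     (\<forall>n\<ge>1. X n \<in> borel_measurable P) \<and>
     (\<forall>n\<ge>1. \<forall>m\<ge>1. n \<noteq> m \<longrightarrow> (LINT \<omega>|P. X n \<omega> * X m \<omega>) = 0) \<and>
     (\<forall>n\<ge>1. (LINT \<omega>|P. X n \<omega>) = 0) \<and>
     (\<forall>n\<ge>1. (LINT \<omega>|P. (X n \<omega>)\<^sup>2) = 1)"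

definition partial_sum :: "(nat \<Rightarrow> 'a \<Rightarrow> real) \<Rightarrow> real \<Rightarrow> 'a \<Rightarrow> real" where
  "partial_sum X u \<omega> = (\<Sum>n = 1..nat \<lfloor>u\<rfloor>. X n \<omega>)"

definition Lq_norm :: "'a measure \<Rightarrow> real \<Rightarrow> ('a \<Rightarrow> real) \<Rightarrow> real" where
  "Lq_norm P q Y = (LINT \<omega>|P. \<bar>Y \<omega>\<bar> powr q) powr (1 / q)"

definition sign_change_on :: "(real \<Rightarrow> real) \<Rightarrow> real set \<Rightarrow> bool" where
  "sign_change_on f I \<longleftrightarrow> (\<exists>u\<in>I. f u > 0) \<and> (\<exists>v\<in>I. f v < 0)"

end

theory Submission
  imports Defs
begin

text \<open>
  Write \<open>M u\<close> for the partial sums and sample them at the \<open>N\<close> geometric points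
  \<open>u\<^sub>j = e\<^sup>j x\<close>, \<open>j < N\<close>, in the normalised form \<open>M u\<^sub>j / sqrt u\<^sub>j\<close>.  The proof compares
  \<open>J = (\<Sum>j<N. M u\<^sub>j / sqrt u\<^sub>j)\<close> with \<open>K = (\<Sum>j<N. \<bar>M u\<^sub>j\<bar> / sqrt u\<^sub>j)\<close>.

  \<^item> \<open>J\<close> shows square root cancellation.  By orthogonality the covariance of \<open>M u\<close> and \<open>M v\<close> is the
    number of terms they share, so the normalised samples \<open>i\<close> and \<open>j\<close> have covariance at most
    \<open>exp (-\<bar>i - j\<bar> / 2)\<close>.  Summing the geometric series gives \<open>E J\<^sup>2 = O(N)\<close>
    (\<open>second_moment_sampled_sum\<close>).
  \<^item> \<open>K\<close> is large in mean.  Comparability of the norms of exponents \<open>q1 < q2\<close> prevents the mass of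
    \<open>M u\<close> from sitting on rare events, so the first absolute moment is comparable to the \<open>q2\<close>-norm
    as well (\<open>L1_norm_lower_bound\<close>).  Since \<open>\<psi>\<close> at most doubles over the whole interval, \<open>E K\<close>
    is at least a constant times \<open>N / \<psi> x\<close>.

  Where \<open>M\<close> has no sign change, \<open>\<bar>J\<bar> = K\<close>.  As \<open>\<psi> x\<^sup>2 = o(N)\<close>, the size \<open>sqrt N\<close> of \<open>J\<close> is
  negligible against \<open>N / \<psi> x\<close>, so most of \<open>E K\<close> must come from the event \<open>B\<close> of a sign change.
  The \<open>q2\<close>-norms control how much of \<open>E K\<close> a small event can carry (\<open>L1_on_event_le\<close>), and
  this bounds the probability of \<open>B\<close> from below
  (\<open>prob_lower_bound_of_cancellation\<close>).  The bound depends only on the ratio between \<open>E \<bar>M u\<bar>\<close>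
  and the \<open>q2\<close>-norm, hence only on \<open>q1\<close>, \<open>q2\<close> and the comparability constant.
\<close>

section \<open>Moments of exponent at most two\<close>

lemma powr_le_one_plus_square:
  fixes y q :: real
  assumes "0 \<le> q" "q \<le> 2"
  shows "\<bar>y\<bar> powr q \<le> 1 + y\<^sup>2"
proof (cases "\<bar>y\<bar> \<le> 1")
  case True
  then have "\<bar>y\<bar> powr q \<le> 1 powr q" using assms by (intro powr_mono2) auto
  then show ?thesis by (simp add: add_increasing2)
next
  case False
  then have "\<bar>y\<bar> powr q \<le> \<bar>y\<bar> powr 2" using assms by (intro powr_mono) auto
  also have "\<dots> = y\<^sup>2" using False by (simp add: powr_numeral)
  finally show ?thesis by simp
qed

lemma (in prob_space) integrable_powr_of_square_integrable:
  fixes Y :: "'a \<Rightarrow> real"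
  assumes [measurable]: "Y \<in> borel_measurable M"
    and "integrable M (\<lambda>\<omega>. (Y \<omega>)\<^sup>2)" "0 \<le> q" "q \<le> 2"
  shows "integrable M (\<lambda>\<omega>. \<bar>Y \<omega>\<bar> powr q)"
proof (rule Bochner_Integration.integrable_bound)
  show "integrable M (\<lambda>\<omega>. 1 + (Y \<omega>)\<^sup>2)" using assms by simp
  show "AE \<omega> in M. norm (\<bar>Y \<omega>\<bar> powr q) \<le> norm (1 + (Y \<omega>)\<^sup>2)"
    using powr_le_one_plus_square[OF assms(3,4)] by (intro AE_I2) (simp add: add_nonneg_nonneg)
qed measurable

lemma (in prob_space) integrable_abs_of_square_integrable:
  fixes Y :: "'a \<Rightarrow> real"
  assumes "Y \<in> borel_measurable M" "integrable M (\<lambda>\<omega>. (Y \<omega>)\<^sup>2)"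
  shows "integrable M (\<lambda>\<omega>. \<bar>Y \<omega>\<bar>)"
  using integrable_powr_of_square_integrable[OF assms, of 1] by simp

lemma Lq_norm_powr:
  assumes "0 < q"
  shows "Lq_norm P q Y powr q = (LINT \<omega>|P. \<bar>Y \<omega>\<bar> powr q)"
  using assms by (simp add: Lq_norm_def powr_powr)

lemma Lq_norm_nonneg: "0 \<le> Lq_norm P q Y"
  by (simp add: Lq_norm_def)

text \<open>Below the level \<open>T\<close> one loses a power of \<open>T\<close> by lowering the exponent from \<open>q1\<close> to \<open>p\<close>,
  above it by raising the exponent to \<open>q2\<close>.  This replaces Hoelder interpolation between norms.\<close>

lemma powr_truncation_bound:
  fixes y T p q1 q2 :: real
  assumes "0 < T" "p \<le> q1" "q1 \<le> q2"
  shows "\<bar>y\<bar> powr q1 \<le> T powr (q1 - p) * \<bar>y\<bar> powr p + T powr (q1 - q2) * \<bar>y\<bar> powr q2"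
proof (cases "\<bar>y\<bar> \<le> T")
  case True
  have "\<bar>y\<bar> powr q1 = \<bar>y\<bar> powr (q1 - p) * \<bar>y\<bar> powr p"
    by (simp flip: powr_add)
  also have "\<dots> \<le> T powr (q1 - p) * \<bar>y\<bar> powr p"
    using True assms by (intro mult_right_mono powr_mono2) auto
  finally show ?thesis by (simp add: add_increasing2)
next
  case False
  have "\<bar>y\<bar> powr q1 = \<bar>y\<bar> powr (q1 - q2) * \<bar>y\<bar> powr q2"
    by (simp flip: powr_add)
  also have "\<dots> \<le> T powr (q1 - q2) * \<bar>y\<bar> powr q2"
    using False assms by (intro mult_right_mono powr_mono2') auto
  finally show ?thesis by (simp add: add_increasing)
qed

text \<open>The truncation level is chosen in units of the \<open>q2\<close>-norm, so that the part of the \<open>q1\<close>-th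
  moment above the level is at most half of it; the other half is then carried by values below
  the level, where the first moment controls it.\<close>

lemma (in prob_space) L1_norm_lower_bound:
  fixes Y :: "'a \<Rightarrow> real"
  assumes Y: "Y \<in> borel_measurable M" "integrable M (\<lambda>\<omega>. (Y \<omega>)\<^sup>2)"
    and q: "1 \<le> q1" "q1 < q2" "q2 \<le> 2" and C: "0 < C"
    and T: "0 < T" "T powr (q1 - q2) \<le> C powr (- q1) / 2"
    and comparable: "Lq_norm M q2 Y \<le> C * Lq_norm M q1 Y"
  shows "C powr (- q1) / 2 * T powr (1 - q1) * Lq_norm M q2 Y \<le> expectation (\<lambda>\<omega>. \<bar>Y \<omega>\<bar>)"
proof (cases "Lq_norm M q2 Y = 0")
  case True
  then show ?thesis by simp
next
  case False
  define s where "s = Lq_norm M q2 Y"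
  have s: "0 < s" using False Lq_norm_nonneg[of M q2 Y] by (simp add: s_def)
  note int = integrable_powr_of_square_integrable[OF Y] integrable_abs_of_square_integrable[OF Y]
  have "(s / C) powr q1 \<le> Lq_norm M q1 Y powr q1"
    using comparable C s q by (intro powr_mono2) (auto simp: s_def field_simps)
  then have "s powr q1 * C powr (- q1) \<le> expectation (\<lambda>\<omega>. \<bar>Y \<omega>\<bar> powr q1)"
    using q C s by (simp add: Lq_norm_powr powr_divide powr_minus_divide)
  also have "\<dots> \<le> expectation (\<lambda>\<omega>. (T * s) powr (q1 - 1) * \<bar>Y \<omega>\<bar> + (T * s) powr (q1 - q2) * \<bar>Y \<omega>\<bar> powr q2)"
  proof (rule integral_mono)
    show "integrable M (\<lambda>\<omega>. \<bar>Y \<omega>\<bar> powr q1)" using q int by auto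
    show "integrable M (\<lambda>\<omega>. (T * s) powr (q1 - 1) * \<bar>Y \<omega>\<bar> + (T * s) powr (q1 - q2) * \<bar>Y \<omega>\<bar> powr q2)"
      using q int by auto
    show "\<bar>Y \<omega>\<bar> powr q1 \<le> (T * s) powr (q1 - 1) * \<bar>Y \<omega>\<bar> + (T * s) powr (q1 - q2) * \<bar>Y \<omega>\<bar> powr q2" for \<omega>
      using powr_truncation_bound[of "T * s" 1 q1 q2 "Y \<omega>"] q T s by simp
  qed
  also have "\<dots> = (T * s) powr (q1 - 1) * expectation (\<lambda>\<omega>. \<bar>Y \<omega>\<bar>) + (T * s) powr (q1 - q2) * s powr q2"
    using q int by (simp add: s_def Lq_norm_powr)
  also have "(T * s) powr (q1 - q2) * s powr q2 = T powr (q1 - q2) * s powr q1"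
    using T s by (simp add: powr_mult flip: powr_add)
  also have "\<dots> \<le> C powr (- q1) / 2 * s powr q1"
    using T by (intro mult_right_mono) auto
  finally have "C powr (- q1) / 2 * s powr q1 \<le> (T * s) powr (q1 - 1) * expectation (\<lambda>\<omega>. \<bar>Y \<omega>\<bar>)"
    by (simp add: field_simps)
  then have "(T * s) powr (1 - q1) * (C powr (- q1) / 2 * s powr q1) \<le>
      (T * s) powr (1 - q1) * ((T * s) powr (q1 - 1) * expectation (\<lambda>\<omega>. \<bar>Y \<omega>\<bar>))"
    by (rule mult_left_mono) simp
  also have "\<dots> = (T * s) powr ((1 - q1) + (q1 - 1)) * expectation (\<lambda>\<omega>. \<bar>Y \<omega>\<bar>)"
    by (simp only: powr_add mult.assoc)
  also have "\<dots> = expectation (\<lambda>\<omega>. \<bar>Y \<omega>\<bar>)" using T s by simp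
  also have "(T * s) powr (1 - q1) * (C powr (- q1) / 2 * s powr q1)
      = C powr (- q1) / 2 * T powr (1 - q1) * s powr ((1 - q1) + q1)"
    using T s by (simp only: powr_add powr_mult) simp
  finally show ?thesis using s by (simp add: s_def)
qed

text \<open>A quantitative form of uniform integrability: an event of small probability carries only a
  small part of the first moment, relative to the norm of an exponent above one.\<close>

lemma (in prob_space) L1_on_event_le:
  fixes Y :: "'a \<Rightarrow> real"
  assumes Y: "Y \<in> borel_measurable M" "integrable M (\<lambda>\<omega>. (Y \<omega>)\<^sup>2)"
    and q: "1 < q" "q \<le> 2" and T: "0 < T" and B[measurable]: "B \<in> events"
    and s: "0 < Lq_norm M q Y"
  shows "expectation (\<lambda>\<omega>. indicator B \<omega> * \<bar>Y \<omega>\<bar>) \<le> Lq_norm M q Y * (T * prob B + T powr (1 - q))"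
proof -
  define s where "s = Lq_norm M q Y"
  have s0: "0 < s" using s by (simp add: s_def)
  note int = integrable_powr_of_square_integrable[OF Y] integrable_abs_of_square_integrable[OF Y]
  have "expectation (\<lambda>\<omega>. indicator B \<omega> * \<bar>Y \<omega>\<bar>)
      \<le> expectation (\<lambda>\<omega>. T * s * indicator B \<omega> + (T * s) powr (1 - q) * \<bar>Y \<omega>\<bar> powr q)"
  proof (rule integral_mono)
    show "integrable M (\<lambda>\<omega>. indicator B \<omega> * \<bar>Y \<omega>\<bar>)"
      using integrable_mult_indicator[OF B, of "\<lambda>\<omega>. \<bar>Y \<omega>\<bar>"] int by simp
    show "integrable M (\<lambda>\<omega>. T * s * indicator B \<omega> + (T * s) powr (1 - q) * \<bar>Y \<omega>\<bar> powr q)"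
      using q int by (auto intro!: integrable_real_indicator simp: emeasure_eq_measure)
    show "indicator B \<omega> * \<bar>Y \<omega>\<bar> \<le> T * s * indicator B \<omega> + (T * s) powr (1 - q) * \<bar>Y \<omega>\<bar> powr q" for \<omega>
    proof (cases "\<omega> \<in> B \<and> Y \<omega> \<noteq> 0")
      case True
      \<comment> \<open>lowering the exponent to \<open>0\<close>, where \<open>\<bar>Y \<omega>\<bar> powr 0 = 1\<close> because \<open>Y \<omega> \<noteq> 0\<close>\<close>
      then show ?thesis
        using powr_truncation_bound[of "T * s" 0 1 q "Y \<omega>"] q T s0 by simp
    next
      case False
      then have *: "indicator B \<omega> * \<bar>Y \<omega>\<bar> = 0" by (auto simp: indicator_def)
      show ?thesis unfolding * using T s0 by (intro add_nonneg_nonneg mult_nonneg_nonneg) auto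
    qed
  qed
  also have "\<dots> = T * s * prob B + (T * s) powr (1 - q) * s powr q"
    using q int by (simp add: s_def Lq_norm_powr emeasure_eq_measure)
  also have "(T * s) powr (1 - q) * s powr q = T powr (1 - q) * s powr ((1 - q) + q)"
    using T s0 by (simp only: powr_mult powr_add)
  finally show ?thesis using s0 by (simp add: s_def algebra_simps)
qed

section \<open>Cancellation forces sign changes\<close>

text \<open>Off \<open>B\<close> the signed sum \<open>J\<close> of the \<open>w j * Y j\<close> agrees in absolute value with the sum of the
  \<open>w j * \<bar>Y j\<bar>\<close>, whose mean is at least \<open>c\<close> times the weighted sum of norms.  The second
  moment of \<open>J\<close> allows it to account for only a quarter of this mean.  The truncation
  level \<open>T\<close> is chosen so that values above it account for at most another quarter.  What remains
  is bounded by \<open>T * prob B\<close>.\<close>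

lemma (in prob_space) prob_lower_bound_of_cancellation:
  fixes Y :: "'i \<Rightarrow> 'a \<Rightarrow> real" and w :: "'i \<Rightarrow> real"
  assumes Y: "\<And>j. j \<in> I \<Longrightarrow> Y j \<in> borel_measurable M"
      "\<And>j. j \<in> I \<Longrightarrow> integrable M (\<lambda>\<omega>. (Y j \<omega>)\<^sup>2)"
    and q: "1 < q" "q \<le> 2" and c: "0 < c" and w: "\<And>j. j \<in> I \<Longrightarrow> 0 \<le> w j"
    and norm_pos: "\<And>j. j \<in> I \<Longrightarrow> 0 < Lq_norm M q (Y j)"
    and L1: "\<And>j. j \<in> I \<Longrightarrow> c * Lq_norm M q (Y j) \<le> expectation (\<lambda>\<omega>. \<bar>Y j \<omega>\<bar>)"
    and B: "B \<in> events"
    and same_sign: "\<And>\<omega>. \<omega> \<in> space M - B \<Longrightarrow> (\<forall>j\<in>I. 0 \<le> Y j \<omega>) \<or> (\<forall>j\<in>I. Y j \<omega> \<le> 0)"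
    and S_pos: "0 < (\<Sum>j\<in>I. w j * Lq_norm M q (Y j))"
    and J_int: "integrable M (\<lambda>\<omega>. (\<Sum>j\<in>I. w j * Y j \<omega>)\<^sup>2)"
    and J_small: "expectation (\<lambda>\<omega>. (\<Sum>j\<in>I. w j * Y j \<omega>)\<^sup>2)
                    \<le> (c / 4 * (\<Sum>j\<in>I. w j * Lq_norm M q (Y j)))\<^sup>2"
    and T: "0 < T" "T powr (1 - q) = c / 4"
  shows "c / (2 * T) \<le> prob B"
proof -
  define S where "S = (\<Sum>j\<in>I. w j * Lq_norm M q (Y j))"
  define J where "J \<omega> = (\<Sum>j\<in>I. w j * Y j \<omega>)" for \<omega>
  define t where "t = c / 4 * S"
  have S: "0 < S" and t: "0 < t" using S_pos c by (auto simp: S_def t_def)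
  have abs_int: "integrable M (\<lambda>\<omega>. \<bar>Y j \<omega>\<bar>)" if "j \<in> I" for j
    using integrable_abs_of_square_integrable Y that by blast
  have ind_int: "integrable M (\<lambda>\<omega>. indicator B \<omega> * \<bar>Y j \<omega>\<bar>)" if "j \<in> I" for j
    using integrable_mult_indicator[OF B abs_int[OF that]] by simp
  have J2_int: "integrable M (\<lambda>\<omega>. (J \<omega>)\<^sup>2)" using J_int by (simp add: J_def)
  have [measurable]: "J \<in> borel_measurable M"
    unfolding J_def using Y by (intro borel_measurable_sum borel_measurable_times) auto
  have Jabs_int: "integrable M (\<lambda>\<omega>. \<bar>J \<omega>\<bar>)"
    using integrable_abs_of_square_integrable[OF _ J2_int] by simp
  have EJ: "expectation (\<lambda>\<omega>. \<bar>J \<omega>\<bar>) \<le> t"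
  proof -
    have "expectation (\<lambda>\<omega>. \<bar>J \<omega>\<bar>) \<le> expectation (\<lambda>\<omega>. (J \<omega>)\<^sup>2 / (2 * t) + t / 2)"
    proof (rule integral_mono[OF Jabs_int])
      show "integrable M (\<lambda>\<omega>. (J \<omega>)\<^sup>2 / (2 * t) + t / 2)" using J2_int by simp
      fix \<omega>
      \<comment> \<open>the inequality of arithmetic and geometric means, in place of Cauchy-Schwarz\<close>
      have "0 \<le> (\<bar>J \<omega>\<bar> - t)\<^sup>2" by simp
      then have "2 * t * \<bar>J \<omega>\<bar> \<le> (J \<omega>)\<^sup>2 + t\<^sup>2"
        by (simp add: power2_diff mult_ac)
      then have "\<bar>J \<omega>\<bar> \<le> ((J \<omega>)\<^sup>2 + t\<^sup>2) / (2 * t)"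
        using t by (simp add: pos_le_divide_eq mult_ac)
      also have "\<dots> = (J \<omega>)\<^sup>2 / (2 * t) + t / 2"
        using t by (simp add: add_divide_distrib power2_eq_square)
      finally show "\<bar>J \<omega>\<bar> \<le> (J \<omega>)\<^sup>2 / (2 * t) + t / 2" .
    qed
    also have "\<dots> = expectation (\<lambda>\<omega>. (J \<omega>)\<^sup>2) / (2 * t) + t / 2"
      using J2_int by (simp add: prob_space)
    also have "\<dots> \<le> t\<^sup>2 / (2 * t) + t / 2"
      using J_small t by (intro add_right_mono divide_right_mono) (auto simp: J_def t_def S_def)
    also have "\<dots> = t" using t by (simp add: power2_eq_square)
    finally show ?thesis .
  qed
  have "c * S \<le> (\<Sum>j\<in>I. w j * expectation (\<lambda>\<omega>. \<bar>Y j \<omega>\<bar>))"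
    unfolding S_def sum_distrib_left
    using L1 w by (intro sum_mono) (subst mult.left_commute, intro mult_left_mono, auto)
  also have "\<dots> = expectation (\<lambda>\<omega>. \<Sum>j\<in>I. w j * \<bar>Y j \<omega>\<bar>)"
    using abs_int by simp
  also have "\<dots> \<le> expectation (\<lambda>\<omega>. \<bar>J \<omega>\<bar> + (\<Sum>j\<in>I. w j * (indicator B \<omega> * \<bar>Y j \<omega>\<bar>)))"
  proof (rule integral_mono)
    show "integrable M (\<lambda>\<omega>. \<Sum>j\<in>I. w j * \<bar>Y j \<omega>\<bar>)" using abs_int by simp
    show "integrable M (\<lambda>\<omega>. \<bar>J \<omega>\<bar> + (\<Sum>j\<in>I. w j * (indicator B \<omega> * \<bar>Y j \<omega>\<bar>)))"
      using ind_int Jabs_int by simp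
    fix \<omega> assume \<omega>: "\<omega> \<in> space M"
    show "(\<Sum>j\<in>I. w j * \<bar>Y j \<omega>\<bar>) \<le> \<bar>J \<omega>\<bar> + (\<Sum>j\<in>I. w j * (indicator B \<omega> * \<bar>Y j \<omega>\<bar>))"
    proof (cases "\<omega> \<in> B")
      case False
      then consider "\<forall>j\<in>I. 0 \<le> Y j \<omega>" | "\<forall>j\<in>I. Y j \<omega> \<le> 0" using same_sign \<omega> by blast
      then have "(\<Sum>j\<in>I. w j * \<bar>Y j \<omega>\<bar>) \<le> \<bar>J \<omega>\<bar>"
      proof cases
        case 1
        then have "(\<Sum>j\<in>I. w j * \<bar>Y j \<omega>\<bar>) = J \<omega>" by (simp add: J_def)
        then show ?thesis by simp
      next
        case 2
        then have "(\<Sum>j\<in>I. w j * \<bar>Y j \<omega>\<bar>) = - J \<omega>" by (simp add: J_def sum_negf)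
        then show ?thesis by simp
      qed
      then show ?thesis using False by simp
    qed simp
  qed
  also have "\<dots> = expectation (\<lambda>\<omega>. \<bar>J \<omega>\<bar>)
      + (\<Sum>j\<in>I. w j * expectation (\<lambda>\<omega>. indicator B \<omega> * \<bar>Y j \<omega>\<bar>))"
    using ind_int Jabs_int by simp
  also have "\<dots> \<le> t + (\<Sum>j\<in>I. w j * (Lq_norm M q (Y j) * (T * prob B + T powr (1 - q))))"
    using EJ w L1_on_event_le[OF Y q T(1) B norm_pos]
    by (intro add_mono sum_mono mult_left_mono) auto
  also have "\<dots> = t + S * (T * prob B + c / 4)"
    by (simp add: S_def T sum_distrib_right mult.assoc)
  finally have "S * (c / 2) \<le> S * (T * prob B)" by (simp add: t_def field_simps)
  then have "c / 2 \<le> T * prob B" using S by simp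
  then show ?thesis using T by (simp add: field_simps)
qed

section \<open>Partial sums of orthonormal variables\<close>

lemma orthonormal_centeredD:
  assumes "orthonormal_centered P X" "1 \<le> n"
  shows "X n \<in> borel_measurable P" "integrable P (\<lambda>\<omega>. (X n \<omega>)\<^sup>2)" "(LINT \<omega>|P. (X n \<omega>)\<^sup>2) = 1"
    and "1 \<le> m \<Longrightarrow> n \<noteq> m \<Longrightarrow> (LINT \<omega>|P. X n \<omega> * X m \<omega>) = 0"
proof -
  show *: "(LINT \<omega>|P. (X n \<omega>)\<^sup>2) = 1" and "X n \<in> borel_measurable P"
    and "1 \<le> m \<Longrightarrow> n \<noteq> m \<Longrightarrow> (LINT \<omega>|P. X n \<omega> * X m \<omega>) = 0"
    using assms by (auto simp: orthonormal_centered_def)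
  \<comment> \<open>the integral of a non-integrable function is 0 by convention\<close>
  show "integrable P (\<lambda>\<omega>. (X n \<omega>)\<^sup>2)"
    using * not_integrable_integral_eq by fastforce
qed

lemma integrable_mult_of_square_integrable:
  fixes f g :: "'a \<Rightarrow> real"
  assumes [measurable]: "f \<in> borel_measurable P" "g \<in> borel_measurable P"
    and "integrable P (\<lambda>\<omega>. (f \<omega>)\<^sup>2)" "integrable P (\<lambda>\<omega>. (g \<omega>)\<^sup>2)"
  shows "integrable P (\<lambda>\<omega>. f \<omega> * g \<omega>)"
proof (rule Bochner_Integration.integrable_bound)
  show "integrable P (\<lambda>\<omega>. (f \<omega>)\<^sup>2 + (g \<omega>)\<^sup>2)" using assms by simp
  have "\<bar>a * b\<bar> \<le> a\<^sup>2 + b\<^sup>2" for a b :: real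
  proof -
    have "2 * \<bar>a * b\<bar> \<le> a\<^sup>2 + b\<^sup>2"
      using sum_squares_bound[of "\<bar>a\<bar>" "\<bar>b\<bar>"] by (simp add: abs_mult)
    then show ?thesis using abs_ge_zero[of "a * b"] by linarith
  qed
  then show "AE \<omega> in P. norm (f \<omega> * g \<omega>) \<le> norm ((f \<omega>)\<^sup>2 + (g \<omega>)\<^sup>2)"
    by (intro AE_I2) simp
qed measurable

lemma partial_sum_measurable:
  assumes "orthonormal_centered P X"
  shows "partial_sum X u \<in> borel_measurable P"
  unfolding partial_sum_def
  using orthonormal_centeredD(1)[OF assms] by (intro borel_measurable_sum) auto

lemma partial_sum_covariance:
  assumes "orthonormal_centered P X"
  shows "integrable P (\<lambda>\<omega>. partial_sum X u \<omega> * partial_sum X v \<omega>)"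
    and "(LINT \<omega>|P. partial_sum X u \<omega> * partial_sum X v \<omega>) = real (min (nat \<lfloor>u\<rfloor>) (nat \<lfloor>v\<rfloor>))"
proof -
  note X = orthonormal_centeredD[OF assms]
  have int: "integrable P (\<lambda>\<omega>. X n \<omega> * X m \<omega>)" if "1 \<le> n" "1 \<le> m" for n m
    using X that by (intro integrable_mult_of_square_integrable) auto
  have E: "(LINT \<omega>|P. X n \<omega> * X m \<omega>) = (if n = m then 1 else 0)" if "1 \<le> n" "1 \<le> m" for n m
    using X that by (auto simp: power2_eq_square)
  show "integrable P (\<lambda>\<omega>. partial_sum X u \<omega> * partial_sum X v \<omega>)"
    unfolding partial_sum_def sum_product
    using int by (intro Bochner_Integration.integrable_sum) auto
  have "(LINT \<omega>|P. partial_sum X u \<omega> * partial_sum X v \<omega>)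
      = (\<Sum>n = 1..nat \<lfloor>u\<rfloor>. \<Sum>m = 1..nat \<lfloor>v\<rfloor>. LINT \<omega>|P. X n \<omega> * X m \<omega>)"
    unfolding partial_sum_def sum_product
    using int by (subst Bochner_Integration.integral_sum;
        (intro Bochner_Integration.integrable_sum sum.cong refl Bochner_Integration.integral_sum)?) auto
  also have "\<dots> = (\<Sum>n = 1..nat \<lfloor>u\<rfloor>. \<Sum>m = 1..nat \<lfloor>v\<rfloor>. if n = m then 1 else 0)"
    using E by (intro sum.cong refl) auto
  also have "\<dots> = (\<Sum>n = 1..nat \<lfloor>u\<rfloor>. if n \<le> nat \<lfloor>v\<rfloor> then 1 else 0)"
    by (intro sum.cong refl) (auto simp: sum.delta)
  also have "\<dots> = real (card ({1..nat \<lfloor>u\<rfloor>} \<inter> {..nat \<lfloor>v\<rfloor>}))"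
    by (simp add: sum.If_cases Int_def)
  also have "{1..nat \<lfloor>u\<rfloor>} \<inter> {..nat \<lfloor>v\<rfloor>} = {1..min (nat \<lfloor>u\<rfloor>) (nat \<lfloor>v\<rfloor>)}" by auto
  finally show "(LINT \<omega>|P. partial_sum X u \<omega> * partial_sum X v \<omega>) = real (min (nat \<lfloor>u\<rfloor>) (nat \<lfloor>v\<rfloor>))"
    by simp
qed

lemma partial_sum_square_integrable:
  assumes "orthonormal_centered P X"
  shows "integrable P (\<lambda>\<omega>. (partial_sum X u \<omega>)\<^sup>2)"
  using partial_sum_covariance(1)[OF assms, of u u] by (simp add: power2_eq_square)

text \<open>The path \<open>u \<mapsto> partial_sum X u\<close> depends on \<open>u\<close> only through \<open>nat \<lfloor>u\<rfloor>\<close>, so the uncountable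
  quantifiers in the event run over a countable set.\<close>

lemma sign_change_event_measurable:
  assumes "orthonormal_centered P X"
  shows "{\<omega> \<in> space P. sign_change_on (\<lambda>u. partial_sum X u \<omega>) I} \<in> sets P"
proof -
  define D where "D = (\<lambda>u::real. nat \<lfloor>u\<rfloor>) ` I"
  have [measurable]: "(\<lambda>\<omega>. \<Sum>n = 1..k. X n \<omega>) \<in> borel_measurable P" for k
    using orthonormal_centeredD(1)[OF assms] by (intro borel_measurable_sum) auto
  have "{\<omega> \<in> space P. sign_change_on (\<lambda>u. partial_sum X u \<omega>) I} =
     {\<omega> \<in> space P. (\<exists>k\<in>D. (\<Sum>n = 1..k. X n \<omega>) > 0) \<and> (\<exists>k\<in>D. (\<Sum>n = 1..k. X n \<omega>) < 0)}"
    by (auto simp: sign_change_on_def partial_sum_def D_def)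
  also have "\<dots> \<in> sets P" by measurable
  finally show ?thesis .
qed

section \<open>The second moment of the sampled sum\<close>

lemma sum_power_le_geometric:
  fixes r :: real
  assumes "0 \<le> r" "r < 1"
  shows "(\<Sum>k<n. r ^ k) \<le> 1 / (1 - r)"
  using assms by (simp add: sum_gp_strict divide_right_mono)

lemma sum_power_dist_le:
  fixes r :: real
  assumes r: "0 \<le> r" "r < 1"
  shows "(\<Sum>j<N. r ^ (max i j - min i j)) \<le> 2 / (1 - r)"
proof -
  let ?f = "\<lambda>j. r ^ (max i j - min i j)"
  have "(\<Sum>j<N. ?f j) \<le> sum ?f ({..<Suc i} \<union> {i..<i + N})"
    using r by (intro sum_mono2) auto
  also have "\<dots> \<le> sum ?f {..<Suc i} + sum ?f {i..<i + N}"
    using r by (subst sum_Un) (auto intro!: sum_nonneg)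
  also have "sum ?f {..<Suc i} = (\<Sum>j<Suc i. r ^ (Suc i - Suc j))"
    by (intro sum.cong) (auto simp: max_def min_def)
  also have "\<dots> = (\<Sum>k<Suc i. r ^ k)" by (rule sum.nat_diff_reindex)
  also have "sum ?f {i..<i + N} = (\<Sum>k<N. r ^ k)"
    by (rule sum.reindex_bij_witness[of _ "\<lambda>k. k + i" "\<lambda>j. j - i"]) (auto simp: max_def min_def)
  also have "(\<Sum>k<Suc i. r ^ k) + (\<Sum>k<N. r ^ k) \<le> 1 / (1 - r) + 1 / (1 - r)"
    by (intro add_mono sum_power_le_geometric r)
  finally show ?thesis by simp
qed

text \<open>For \<open>i \<le> j\<close> the normalised covariance is at most \<open>sqrt (u\<^sub>i / u\<^sub>j)\<close>, a power of
  \<open>exp (- 1 / 2)\<close>.\<close>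

lemma normalised_covariance_le:
  assumes X: "orthonormal_centered P X" and x: "0 < x"
  defines "u \<equiv> \<lambda>j. exp (real j) * x"
  shows "(LINT \<omega>|P. (1 / sqrt (u i) * partial_sum X (u i) \<omega>) * (1 / sqrt (u j) * partial_sum X (u j) \<omega>))
           \<le> exp (- 1 / 2) ^ (max i j - min i j)"
proof -
  have main: "(LINT \<omega>|P. (1 / sqrt (u i) * partial_sum X (u i) \<omega>) * (1 / sqrt (u j) * partial_sum X (u j) \<omega>))
           \<le> exp (- 1 / 2) ^ (j - i)" if "i \<le> j" for i j
  proof -
    have u: "0 < u i" "0 < u j" using x by (auto simp: u_def)
    have "(LINT \<omega>|P. (1 / sqrt (u i) * partial_sum X (u i) \<omega>) * (1 / sqrt (u j) * partial_sum X (u j) \<omega>))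
        = (LINT \<omega>|P. 1 / (sqrt (u i) * sqrt (u j)) * (partial_sum X (u i) \<omega> * partial_sum X (u j) \<omega>))"
      by (simp add: mult_ac)
    also have "\<dots> = 1 / (sqrt (u i) * sqrt (u j)) * real (min (nat \<lfloor>u i\<rfloor>) (nat \<lfloor>u j\<rfloor>))"
      by (subst integral_mult_right_zero) (simp only: partial_sum_covariance(2)[OF X])
    also have "\<dots> \<le> 1 / (sqrt (u i) * sqrt (u j)) * u i"
    proof (rule mult_left_mono)
      have "real (min (nat \<lfloor>u i\<rfloor>) (nat \<lfloor>u j\<rfloor>)) \<le> real (nat \<lfloor>u i\<rfloor>)" by simp
      also have "\<dots> \<le> u i" using u by (intro of_nat_floor) auto
      finally show "real (min (nat \<lfloor>u i\<rfloor>) (nat \<lfloor>u j\<rfloor>)) \<le> u i" .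
      show "0 \<le> 1 / (sqrt (u i) * sqrt (u j))" using u by simp
    qed
    also have "\<dots> = sqrt (u i) / sqrt (u j)"
      using u by (simp add: field_simps)
    also have "\<dots> = sqrt (exp (real i - real j))"
      using x by (simp add: u_def exp_diff flip: real_sqrt_divide)
    also have "\<dots> = exp ((real i - real j) / 2)"
      by (rule real_sqrt_unique) (auto simp: power2_eq_square simp flip: exp_add)
    also have "\<dots> = exp (- 1 / 2) ^ (j - i)"
      using that by (simp add: of_nat_diff field_simps flip: exp_of_nat_mult)
    finally show ?thesis .
  qed
  show ?thesis
  proof (cases "i \<le> j")
    case True
    then show ?thesis using main[of i j] by (simp add: max_def min_def)
  next
    case False
    then show ?thesis using main[of j i] by (simp add: max_def min_def mult.commute)
  qed
qed

lemma second_moment_sampled_sum: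
  assumes X: "orthonormal_centered P X" and x: "0 < x"
  defines "u \<equiv> \<lambda>j. exp (real j) * x"
  shows "integrable P (\<lambda>\<omega>. (\<Sum>j<N. 1 / sqrt (u j) * partial_sum X (u j) \<omega>)\<^sup>2)"
    and "(LINT \<omega>|P. (\<Sum>j<N. 1 / sqrt (u j) * partial_sum X (u j) \<omega>)\<^sup>2)
           \<le> 2 / (1 - exp (- 1 / 2)) * real N"
proof -
  let ?Z = "\<lambda>j \<omega>. 1 / sqrt (u j) * partial_sum X (u j) \<omega>"
  have int: "integrable P (\<lambda>\<omega>. ?Z i \<omega> * ?Z j \<omega>)" for i j
    using integrable_mult_right[OF partial_sum_covariance(1)[OF X, of "u i" "u j"], of "1 / (sqrt (u i) * sqrt (u j))"]
    by (simp add: mult_ac)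
  have sq: "(\<lambda>\<omega>. (\<Sum>j<N. ?Z j \<omega>)\<^sup>2) = (\<lambda>\<omega>. \<Sum>i<N. \<Sum>j<N. ?Z i \<omega> * ?Z j \<omega>)"
    by (simp only: power2_eq_square sum_product)
  show "integrable P (\<lambda>\<omega>. (\<Sum>j<N. ?Z j \<omega>)\<^sup>2)"
    unfolding sq by (intro Bochner_Integration.integrable_sum int)
  have "(LINT \<omega>|P. (\<Sum>j<N. ?Z j \<omega>)\<^sup>2) = (\<Sum>i<N. \<Sum>j<N. LINT \<omega>|P. ?Z i \<omega> * ?Z j \<omega>)"
    unfolding sq by (subst Bochner_Integration.integral_sum;
        (intro Bochner_Integration.integrable_sum int sum.cong refl Bochner_Integration.integral_sum)?)
  also have "\<dots> \<le> (\<Sum>i<N. \<Sum>j<N. exp (- 1 / 2) ^ (max i j - min i j))"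
    unfolding u_def by (intro sum_mono normalised_covariance_le[OF X x])
  also have "\<dots> \<le> (\<Sum>i<N. 2 / (1 - exp (- 1 / 2)))"
    by (intro sum_mono sum_power_dist_le) auto
  finally show "(LINT \<omega>|P. (\<Sum>j<N. ?Z j \<omega>)\<^sup>2) \<le> 2 / (1 - exp (- 1 / 2)) * real N"
    by (simp add: mult.commute)
qed

section \<open>The growth condition\<close>

text \<open>Either \<open>\<psi> x\<close> is so large that the factor \<open>\<psi> x powr \<epsilon>\<close> gained in the hypothesis beats the
  constant, or it is bounded and \<open>N x\<close> is eventually larger.\<close>

lemma eventually_square_le_mult:
  fixes \<psi> :: "real \<Rightarrow> real" and N :: "real \<Rightarrow> nat"
  assumes \<psi>: "\<And>x. 1 \<le> x \<Longrightarrow> 1 \<le> \<psi> x" and \<epsilon>: "0 < \<epsilon>"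
    and N: "filterlim N at_top at_top"
    and O: "(\<lambda>x. \<psi> x powr (2 + \<epsilon>)) \<in> O[at_top](\<lambda>x. real (N x))"
    and b: "0 < b"
  shows "\<forall>\<^sub>F x in at_top. (\<psi> x)\<^sup>2 \<le> b * real (N x)"
proof -
  obtain D where D: "0 < D" "\<forall>\<^sub>F x in at_top. \<psi> x powr (2 + \<epsilon>) \<le> D * real (N x)"
    using O by (auto elim!: landau_o.bigE)
  define L where "L = (D / b) powr (1 / \<epsilon>)"
  have NL: "\<forall>\<^sub>F x in at_top. L\<^sup>2 / b \<le> real (N x)"
    using filterlim_compose[OF filterlim_real_sequentially N] by (simp add: filterlim_at_top)
  show ?thesis
    using D(2) NL eventually_ge_at_top[of 1]
  proof eventually_elim
    case (elim x)
    have \<psi>x: "1 \<le> \<psi> x" using \<psi> elim by simp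
    show ?case
    proof (cases "\<psi> x \<le> L")
      case True
      then have "(\<psi> x)\<^sup>2 \<le> L\<^sup>2" using \<psi>x by (intro power_mono) auto
      also have "\<dots> \<le> b * real (N x)" using elim b by (simp add: field_simps)
      finally show ?thesis .
    next
      case False
      have "D / b = L powr \<epsilon>" using D b \<epsilon> by (simp add: L_def powr_powr)
      also have "\<dots> \<le> \<psi> x powr \<epsilon>"
        using False \<epsilon> by (intro powr_mono2) (auto simp: L_def)
      finally have "(\<psi> x)\<^sup>2 * (D / b) \<le> (\<psi> x)\<^sup>2 * \<psi> x powr \<epsilon>"
        by (intro mult_left_mono) auto
      also have "\<dots> = \<psi> x powr (2 + \<epsilon>)"
        using \<psi>x by (simp add: powr_add powr_numeral)
      also have "\<dots> \<le> D * real (N x)" using elim by simp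
      finally show ?thesis using D b by (simp add: field_simps)
    qed
  qed
qed

lemma eventually_at_most_doubles:
  fixes \<psi> :: "real \<Rightarrow> real" and N :: "real \<Rightarrow> nat"
  assumes \<psi>: "\<And>x. 1 \<le> x \<Longrightarrow> 1 \<le> \<psi> x"
    and N: "(\<lambda>x. real (N x)) \<in> o[at_top](\<lambda>x. ln x)"
    and O: "(\<lambda>x. \<psi> (exp (real (N x)) * x) / \<psi> x - 1) \<in> O[at_top](\<lambda>x. real (N x) / ln x)"
  shows "\<forall>\<^sub>F x in at_top. \<psi> (exp (real (N x)) * x) \<le> 2 * \<psi> x"
proof -
  have "(\<lambda>x. real (N x) / ln x) \<in> o[at_top](\<lambda>_. 1)"
    using smalloD_tendsto[OF N] by (intro smalloI_tendsto) auto
  from landau_o.big_small_trans[OF O this]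
  have "\<forall>\<^sub>F x in at_top. norm (\<psi> (exp (real (N x)) * x) / \<psi> x - 1) \<le> 1 * norm (1::real)"
    by (rule landau_o.smallD) simp
  then show ?thesis
    using eventually_ge_at_top[of 1]
  proof eventually_elim
    case (elim x)
    then have "\<psi> (exp (real (N x)) * x) / \<psi> x \<le> 2" by (auto simp: abs_le_iff)
    then show ?case using \<psi>[of x] elim by (simp add: field_simps)
  qed
qed

section \<open>Sign changes of the partial sums\<close>

theorem theorem1p2:
  fixes q1 q2 C :: real
  assumes "1 \<le> q1" and "q1 < q2" and "q2 \<le> 2" and "0 < C"
  shows "\<exists>\<kappa>>0. \<forall>(P :: 'a measure) (X :: nat \<Rightarrow> 'a \<Rightarrow> real) (\<psi> :: real \<Rightarrow> real)
            (\<epsilon> :: real) (N :: real \<Rightarrow> nat).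
      prob_space P \<longrightarrow>
      orthonormal_centered P X \<longrightarrow>
      (\<forall>\<^sub>F x in at_top.
          Lq_norm P q1 (partial_sum X x) \<le> C * Lq_norm P q2 (partial_sum X x) \<and>
          Lq_norm P q2 (partial_sum X x) \<le> C * Lq_norm P q1 (partial_sum X x)) \<longrightarrow>
      continuous_on {1..} \<psi> \<longrightarrow>
      mono_on {1..} \<psi> \<longrightarrow>
      (\<forall>x\<ge>1. \<psi> x \<ge> 1) \<longrightarrow>
      (\<lambda>x. Lq_norm P q1 (partial_sum X x)) \<in> \<Theta>[at_top](\<lambda>x. sqrt x / \<psi> x) \<longrightarrow>
      (\<forall>n :: real \<Rightarrow> nat.
          (\<forall>x. 0 < n x) \<longrightarrow>
          (\<lambda>x. real (n x)) \<in> o[at_top](\<lambda>x. ln x) \<longrightarrow>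
          (\<lambda>x. \<psi> (exp (real (n x)) * x) / \<psi> x - 1) \<in> O[at_top](\<lambda>x. real (n x) / ln x)) \<longrightarrow>
      0 < \<epsilon> \<longrightarrow> \<epsilon> < 1 / 100 \<longrightarrow>
      (\<forall>x. 0 < N x) \<longrightarrow>
      filterlim N at_top at_top \<longrightarrow>
      (\<lambda>x. \<psi> x powr (2 + \<epsilon>)) \<in> O[at_top](\<lambda>x. real (N x)) \<longrightarrow>
      (\<lambda>x. real (N x)) \<in> o[at_top](\<lambda>x. ln x) \<longrightarrow>
      (\<forall>\<^sub>F x in at_top.
          measure P {\<omega> \<in> space P.
            sign_change_on (\<lambda>u. partial_sum X u \<omega>) {x..exp (real (N x)) * x}} \<ge> \<kappa>)"
proof -
  \<comment> \<open>\<open>c\<close> is the resulting ratio of the first moment to the \<open>q2\<close>-norm, \<open>T1\<close> and \<open>T2\<close> are the two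
      truncation levels.\<close>
  define T1 where "T1 = (C powr (- q1) / 2) powr (1 / (q1 - q2))"
  define c where "c = C powr (- q1) / 2 * T1 powr (1 - q1)"
  define T2 where "T2 = (c / 4) powr (1 / (1 - q2))"
  have T1: "0 < T1" "T1 powr (q1 - q2) = C powr (- q1) / 2"
    using assms by (auto simp: T1_def powr_powr)
  have c: "0 < c" using T1 assms by (simp add: c_def)
  have T2: "0 < T2" "T2 powr (1 - q2) = c / 4"
    using assms c by (auto simp: T2_def powr_powr)
  define \<kappa> where "\<kappa> = c / (2 * T2)"
  have \<kappa>: "0 < \<kappa>" using c T2 by (simp add: \<kappa>_def)
  have bound: "\<forall>\<^sub>F x in at_top. \<kappa> \<le> measure P {\<omega> \<in> space P.
            sign_change_on (\<lambda>u. partial_sum X u \<omega>) {x..exp (real (N x)) * x}}"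
    if P: "prob_space P" and X: "orthonormal_centered P X"
      and lin: "\<forall>\<^sub>F x in at_top.
          Lq_norm P q1 (partial_sum X x) \<le> C * Lq_norm P q2 (partial_sum X x) \<and>
          Lq_norm P q2 (partial_sum X x) \<le> C * Lq_norm P q1 (partial_sum X x)"
      and mono: "mono_on {1..} \<psi>" and \<psi>: "\<forall>x\<ge>1. \<psi> x \<ge> 1"
      and size: "(\<lambda>x. Lq_norm P q1 (partial_sum X x)) \<in> \<Theta>[at_top](\<lambda>x. sqrt x / \<psi> x)"
      and slow: "(\<lambda>x. \<psi> (exp (real (N x)) * x) / \<psi> x - 1) \<in> O[at_top](\<lambda>x. real (N x) / ln x)"
      and \<epsilon>: "0 < \<epsilon>" and N_pos: "\<forall>x. 0 < N x" and N_lim: "filterlim N at_top at_top"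
      and N_big: "(\<lambda>x. \<psi> x powr (2 + \<epsilon>)) \<in> O[at_top](\<lambda>x. real (N x))"
      and N_small: "(\<lambda>x. real (N x)) \<in> o[at_top](\<lambda>x. ln x)"
    for P :: "'a measure" and X :: "nat \<Rightarrow> 'a \<Rightarrow> real" and \<psi> :: "real \<Rightarrow> real"
      and \<epsilon> :: real and N :: "real \<Rightarrow> nat"
  proof -
    interpret prob_space P by (rule P)
    have \<psi>1: "1 \<le> \<psi> x" if "1 \<le> x" for x using \<psi> that by simp
    define K :: real where "K = 2 / (1 - exp (- 1 / 2))"
    have K: "0 < K" by (simp add: K_def)
    obtain a where a: "0 < a"
      "\<forall>\<^sub>F x in at_top. a * norm (sqrt x / \<psi> x) \<le> norm (Lq_norm P q1 (partial_sum X x))"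
      using bigthetaD2[OF size] by (auto elim!: landau_omega.bigE)
    have "\<forall>\<^sub>F u in at_top. Lq_norm P q2 (partial_sum X u) \<le> C * Lq_norm P q1 (partial_sum X u)
          \<and> a / C * (sqrt u / \<psi> u) \<le> Lq_norm P q2 (partial_sum X u)"
      using lin a(2) eventually_ge_at_top[of 1]
    proof eventually_elim
      case (elim u)
      have n: "0 \<le> Lq_norm P q1 (partial_sum X u)" by (rule Lq_norm_nonneg)
      have "norm (sqrt u / \<psi> u) = sqrt u / \<psi> u" using \<psi>1[of u] elim by simp
      then have "a * (sqrt u / \<psi> u) \<le> Lq_norm P q1 (partial_sum X u)"
        using elim n by (simp only: real_norm_def abs_of_nonneg)
      also have "\<dots> \<le> C * Lq_norm P q2 (partial_sum X u)" using elim by simp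
      finally have le: "a * (sqrt u / \<psi> u) \<le> Lq_norm P q2 (partial_sum X u) * C"
        by (simp only: mult.commute)
      have "a / C * (sqrt u / \<psi> u) = a * (sqrt u / \<psi> u) / C" by simp
      also have "\<dots> \<le> Lq_norm P q2 (partial_sum X u)"
        using le by (simp only: pos_divide_le_eq[OF assms(4)])
      finally show ?case using elim by blast
    qed
    then obtain x0 where x0: "\<And>u. x0 \<le> u \<Longrightarrow>
        Lq_norm P q2 (partial_sum X u) \<le> C * Lq_norm P q1 (partial_sum X u)
        \<and> a / C * (sqrt u / \<psi> u) \<le> Lq_norm P q2 (partial_sum X u)"
      unfolding eventually_at_top_linorder by blast
    \<comment> \<open>\<open>d * N x / \<psi> x\<close> will be a lower bound for a quarter of the mean of the absolute sampled sum.\<close>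
    define d where "d = c / 4 * (a / C / 2)"
    have d: "0 < d" using c a assms(4) by (simp add: d_def)
    have sq: "\<forall>\<^sub>F x in at_top. (\<psi> x)\<^sup>2 \<le> d\<^sup>2 / K * real (N x)"
      using d K by (intro eventually_square_le_mult[OF \<psi>1 \<epsilon> N_lim N_big]) auto
    have dbl: "\<forall>\<^sub>F x in at_top. \<psi> (exp (real (N x)) * x) \<le> 2 * \<psi> x"
      by (rule eventually_at_most_doubles[OF \<psi>1 N_small slow])
    show ?thesis
      using sq dbl eventually_ge_at_top[of "max 1 x0"]
    proof eventually_elim
      case (elim x)
      then have x: "1 \<le> x" "x0 \<le> x" by auto
      define n where "n = N x"
      have n: "0 < n" using N_pos by (simp add: n_def)
      define u where "u j = exp (real j) * x" for j :: nat
      define Y where "Y j = partial_sum X (u j)" for j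
      define w where "w j = 1 / sqrt (u j)" for j
      define B where "B = {\<omega> \<in> space P. sign_change_on (\<lambda>u. partial_sum X u \<omega>) {x..exp (real n) * x}}"
      define S where "S = (\<Sum>j<n. w j * Lq_norm P q2 (Y j))"
      have ux: "x \<le> u j" for j using x by (simp add: u_def)
      then have u1: "1 \<le> u j" and u0: "x0 \<le> u j" for j using x order_trans by blast+
      have un: "u j \<le> exp (real n) * x" if "j < n" for j
        using that x by (simp add: u_def)
      have un1: "1 \<le> exp (real n) * x" using un[OF n] u1[of 0] by linarith
      have w: "0 < w j" for j using u1[of j] by (simp add: w_def)
      have low: "a / C / 2 / \<psi> x \<le> w j * Lq_norm P q2 (Y j)" if j: "j < n" for j
      proof -
        have "\<psi> (u j) \<le> \<psi> (exp (real n) * x)"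
          using u1[of j] un[OF j] un1 by (intro mono_onD[OF mono]) auto
        then have le: "\<psi> (u j) \<le> 2 * \<psi> x" using elim by (simp add: n_def)
        have "a / C / 2 / \<psi> x = a / C / (2 * \<psi> x)" by simp
        also have "\<dots> \<le> a / C / \<psi> (u j)"
          using le \<psi>1[OF u1[of j]] a assms(4) by (intro divide_left_mono) auto
        also have "\<dots> = w j * (a / C * (sqrt (u j) / \<psi> (u j)))"
          using u1[of j] by (simp add: w_def)
        also have "\<dots> \<le> w j * Lq_norm P q2 (Y j)"
          using x0[OF u0[of j]] w[of j] by (intro mult_left_mono) (auto simp: Y_def)
        finally show ?thesis .
      qed
      have low_pos: "0 < a / C / 2 / \<psi> x" using a assms(4) \<psi>1[OF x(1)] by simp
      have "(\<Sum>j<n. a / C / 2 / \<psi> x) \<le> S"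
        unfolding S_def using low by (intro sum_mono) auto
      then have S: "real n * (a / C / 2 / \<psi> x) \<le> S" by simp
      have S_pos: "0 < S" using S low_pos n by (smt (verit) mult_pos_pos of_nat_0_less_iff)
      have "c / (2 * T2) \<le> prob B"
      proof (rule prob_lower_bound_of_cancellation[where Y = Y and w = w and I = "{..<n}" and q = q2])
        show "Y j \<in> borel_measurable P" for j
          unfolding Y_def by (rule partial_sum_measurable[OF X])
        show "integrable P (\<lambda>\<omega>. (Y j \<omega>)\<^sup>2)" for j
          unfolding Y_def by (rule partial_sum_square_integrable[OF X])
        show "1 < q2" "q2 \<le> 2" "0 < c" "0 < T2" "T2 powr (1 - q2) = c / 4"
          using assms c T2 by auto
        show "0 \<le> w j" for j using w[of j] by simp
        show "0 < Lq_norm P q2 (Y j)" if "j \<in> {..<n}" for j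
          using low[of j] that low_pos w[of j] by (smt (verit) lessThan_iff mult_nonneg_nonpos)
        show "c * Lq_norm P q2 (Y j) \<le> expectation (\<lambda>\<omega>. \<bar>Y j \<omega>\<bar>)" for j
          unfolding c_def Y_def
          using x0[OF u0[of j]] T1 assms
          by (intro L1_norm_lower_bound partial_sum_measurable[OF X]
              partial_sum_square_integrable[OF X]) auto
        show "B \<in> events" unfolding B_def by (rule sign_change_event_measurable[OF X])
        show "(\<forall>j\<in>{..<n}. 0 \<le> Y j \<omega>) \<or> (\<forall>j\<in>{..<n}. Y j \<omega> \<le> 0)" if "\<omega> \<in> space P - B" for \<omega>
        proof -
          have "u j \<in> {x..exp (real n) * x}" if "j < n" for j using ux un that by simp
          then show ?thesis
            using that unfolding B_def sign_change_on_def Y_def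
            by (auto simp: not_less)
        qed
        show "0 < (\<Sum>j<n. w j * Lq_norm P q2 (Y j))" using S_pos by (simp add: S_def)
        show "integrable P (\<lambda>\<omega>. (\<Sum>j<n. w j * Y j \<omega>)\<^sup>2)"
          unfolding w_def Y_def u_def by (rule second_moment_sampled_sum(1)[OF X]) (use x in auto)
        have "expectation (\<lambda>\<omega>. (\<Sum>j<n. w j * Y j \<omega>)\<^sup>2) \<le> K * real n"
          unfolding w_def Y_def u_def K_def by (rule second_moment_sampled_sum(2)[OF X]) (use x in auto)
        also have "\<dots> \<le> (d * real n / \<psi> x)\<^sup>2"
        proof -
          have "K * (\<psi> x)\<^sup>2 \<le> d\<^sup>2 * real n" using elim K by (simp add: n_def field_simps)
          then have "K * (\<psi> x)\<^sup>2 * real n \<le> d\<^sup>2 * real n * real n" by (rule mult_right_mono) simp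
          then show ?thesis using \<psi>1[OF x(1)]
            by (simp add: power_divide power_mult_distrib pos_le_divide_eq power2_eq_square mult_ac)
        qed
        also have "\<dots> \<le> (c / 4 * S)\<^sup>2"
        proof (rule power_mono)
          have "d * real n / \<psi> x = c / 4 * (real n * (a / C / 2 / \<psi> x))" by (simp add: d_def mult_ac)
          also have "\<dots> \<le> c / 4 * S" using S c by (intro mult_left_mono) auto
          finally show "d * real n / \<psi> x \<le> c / 4 * S" .
          show "0 \<le> d * real n / \<psi> x" using d \<psi>1[OF x(1)] by simp
        qed
        finally show "expectation (\<lambda>\<omega>. (\<Sum>j<n. w j * Y j \<omega>)\<^sup>2)
            \<le> (c / 4 * (\<Sum>j<n. w j * Lq_norm P q2 (Y j)))\<^sup>2" by (simp add: S_def)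
      qed
      then show ?case by (simp add: \<kappa>_def B_def n_def)
    qed
  qed
  show ?thesis
    using \<kappa> bound by (intro exI[of _ \<kappa>] conjI allI impI) blast+
qed

end
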